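(* Let $\{v_1,v_2,\ldots,v_n\}$ be a set of linearly independent vectors in a (Hausdorff) locally convex real vector space $V$, and let $X$ be the convex hull of $\{v_1,v_2,\ldots,v_n\}$. Let $T$ be a topological semigroup acting on $X$ by affine surjective maps. Then the action of $T$ on $X$ is proximal if and only if the action of $T$ on $X$ is strongly proximal.
   Context: An affine action of a semigroup $T$ on a closed convex subset $X$ of a locally convex vector space is an action of $T$ on $X$ (by continuous selfmaps) such that $t(ax+(1-a)y)=a\,t(x)+(1-a)\,t(y)$ for all $t\in T$, $x,y\in X$ and $0\le a\le 1$. The action here is affine and each $t\in T$ maps $X$ onto $X$. The set $X$ carries the topology induced from $V$, for which it is compact and metrizable. The action of $T$ on $X$ is called proximal if for any $x,y\in X$ there exists a sequence $(t_n)$ in $T$ such that $\lim t_nx$ and $\lim t_ny$ exist in $X$ and are equal. ${\cal P}(X)$ denotes the space of all regular Borel probability measures on $X$ with the weak* topology with respect to all bounded continuous functions; $\delta_x$ is the point mass at $x$; $T$ acts on ${\cal P}(X)$ by $(t\lambda)(E)=\lambda(t^{-1}E)$ for Borel $E\subset X$. The action of $T$ on $X$ is called strongly proximal if for every $\lambda\in{\cal P}(X)$ there exist a sequence $(t_n)$ in $T$ and a point $x\in X$ such that $t_n\lambda\to\delta_x$ in ${\cal P}(X)$. *)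

theory Defs
  imports "HOL-Probability.Probability"
begin

class locally_convex_space = real_vector + topological_ab_group_add + t2_space +
  assumes tendsto_scaleR_Pair: "LIM x (nhds a \<times>\<^sub>F nhds b). fst x *\<^sub>R snd x :> nhds (a *\<^sub>R b)"
    (* convexity of C is unfolded because the constant convex is not available inside a class specification *)
    and open_base_0_unfolded: "open U \<Longrightarrow> 0 \<in> U \<Longrightarrow> \<exists>C. open C \<and>
      (\<forall>x\<in>C. \<forall>y\<in>C. \<forall>u\<ge>0. \<forall>v\<ge>0. u + v = 1 \<longrightarrow> u *\<^sub>R x + v *\<^sub>R y \<in> C) \<and>
      0 \<in> C \<and> C \<subseteq> U"

lemma convex_open_base_0:
  fixes U :: "'a::locally_convex_space set"
  assumes "open U" "0 \<in> U"
  shows "\<exists>C. open C \<and> convex C \<and> 0 \<in> C \<and> C \<subseteq> U"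
  using open_base_0_unfolded[OF assms] by (simp add: convex_def)

instance real_normed_vector \<subseteq> locally_convex_space
proof
  fix a :: real and b :: 'a
  show "LIM x (nhds a \<times>\<^sub>F nhds b). fst x *\<^sub>R snd x :> nhds (a *\<^sub>R b)"
    by (intro tendsto_scaleR filterlim_fst filterlim_snd)
next
  fix U :: "'a set"
  assume "open U" "0 \<in> U"
  then obtain e where "0 < e" "ball 0 e \<subseteq> U"
    using open_contains_ball by blast
  then show "\<exists>C. open C \<and>
      (\<forall>x\<in>C. \<forall>y\<in>C. \<forall>u\<ge>0. \<forall>v\<ge>0. u + v = 1 \<longrightarrow> u *\<^sub>R x + v *\<^sub>R y \<in> C) \<and>
      0 \<in> C \<and> C \<subseteq> U"
    using convex_ball[of "0 :: 'a" e] unfolding convex_def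
    by (intro exI[of _ "ball 0 e"]) auto
qed

(* The behaviour of act t outside X is irrelevant throughout. *)

definition semigroup_action :: "('t::semigroup_mult \<Rightarrow> 'a::topological_space \<Rightarrow> 'a) \<Rightarrow> 'a set \<Rightarrow> bool" where
  "semigroup_action act X \<longleftrightarrow>
     (\<forall>t. \<forall>x\<in>X. act t x \<in> X) \<and>
     (\<forall>s t. \<forall>x\<in>X. act (s * t) x = act s (act t x)) \<and>
     (\<forall>t. continuous_on X (act t))"

definition affine_action ::
    "('t::semigroup_mult \<Rightarrow> 'v::{real_vector,topological_space} \<Rightarrow> 'v) \<Rightarrow> 'v set \<Rightarrow> bool" where
  "affine_action act X \<longleftrightarrow> semigroup_action act X \<and>
     (\<forall>t. \<forall>x\<in>X. \<forall>y\<in>X. \<forall>a::real. 0 \<le> a \<and> a \<le> 1 \<longrightarrow>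
        act t (a *\<^sub>R x + (1 - a) *\<^sub>R y) = a *\<^sub>R act t x + (1 - a) *\<^sub>R act t y)"

definition proximal :: "('t \<Rightarrow> 'a::topological_space \<Rightarrow> 'a) \<Rightarrow> 'a set \<Rightarrow> bool" where
  "proximal act X \<longleftrightarrow>
     (\<forall>x\<in>X. \<forall>y\<in>X. \<exists>(t :: nat \<Rightarrow> 't) z. z \<in> X \<and>
        (\<lambda>n. act (t n) x) \<longlonglongrightarrow> z \<and> (\<lambda>n. act (t n) y) \<longlonglongrightarrow> z)"

(* restrict_space borel X is the Borel sigma-algebra of the subspace topology on X. *)

definition borel_regular :: "'a::topological_space set \<Rightarrow> 'a measure \<Rightarrow> bool" where
  "borel_regular X M \<longleftrightarrow>
     (\<forall>E\<in>sets M.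
        emeasure M E = (INF U\<in>{U. openin (top_of_set X) U \<and> E \<subseteq> U}. emeasure M U) \<and>
        emeasure M E = (SUP K\<in>{K. compact K \<and> K \<subseteq> E}. emeasure M K))"

definition borel_probs :: "'a::topological_space set \<Rightarrow> 'a measure set" where
  "borel_probs X =
     {M. prob_space M \<and> sets M = sets (restrict_space borel X) \<and> borel_regular X M}"

definition weak_star_topology :: "'a::topological_space set \<Rightarrow> 'a measure topology" where
  "weak_star_topology X = topology_generated_by
     {{M \<in> borel_probs X. (\<integral>x. f x \<partial>M) \<in> U} | (f :: 'a \<Rightarrow> real) U.
        continuous_on X f \<and> bounded (f ` X) \<and> open U}"

lemma topspace_weak_star [simp]: "topspace (weak_star_topology X) = borel_probs X"
proof -
  have "\<exists>f U. borel_probs X = {M \<in> borel_probs X. (\<integral>x. f x \<partial>M) \<in> U} \<and>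
      continuous_on X f \<and> bounded (f ` X) \<and> open (U :: real set)"
    by (rule exI[of _ "\<lambda>_. 0"], rule exI[of _ UNIV])
      (auto simp: image_constant_conv)
  then show ?thesis
    unfolding weak_star_topology_def topology_generated_by_topspace by blast
qed

lemma limitin_weak_star:
  assumes "\<And>n. M n \<in> borel_probs X"
  shows "limitin (weak_star_topology X) M L F \<longleftrightarrow> L \<in> borel_probs X \<and>
     (\<forall>f :: 'a::topological_space \<Rightarrow> real. continuous_on X f \<and> bounded (f ` X) \<longrightarrow>
        ((\<lambda>n. \<integral>x. f x \<partial>M n) \<longlongrightarrow> (\<integral>x. f x \<partial>L)) F)"
    (is "?lim \<longleftrightarrow> _ \<and> ?int")
proof (intro iffI conjI allI impI)
  assume lim: ?lim
  then show "L \<in> borel_probs X"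
    by (simp add: limitin_def)
  fix f :: "'a \<Rightarrow> real"
  assume f: "continuous_on X f \<and> bounded (f ` X)"
  show "((\<lambda>n. \<integral>x. f x \<partial>M n) \<longlongrightarrow> (\<integral>x. f x \<partial>L)) F"
  proof (rule topological_tendstoI)
    fix U :: "real set"
    assume U: "open U" "(\<integral>x. f x \<partial>L) \<in> U"
    have "openin (weak_star_topology X) {M \<in> borel_probs X. (\<integral>x. f x \<partial>M) \<in> U}"
      unfolding weak_star_topology_def by (rule topology_generated_by_Basis) (use f U in blast)
    with lim U \<open>L \<in> borel_probs X\<close>
    have "\<forall>\<^sub>F n in F. M n \<in> {M \<in> borel_probs X. (\<integral>x. f x \<partial>M) \<in> U}"
      by (auto simp: limitin_def)
    then show "\<forall>\<^sub>F n in F. (\<integral>x. f x \<partial>M n) \<in> U"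
      by (rule eventually_mono) auto
  qed
next
  assume R: "L \<in> borel_probs X \<and> ?int"
  have "L \<in> W \<longrightarrow> (\<forall>\<^sub>F n in F. M n \<in> W)"
    if "generate_topology_on {{M \<in> borel_probs X. (\<integral>x. f x \<partial>M) \<in> U} | (f :: 'a \<Rightarrow> real) U.
        continuous_on X f \<and> bounded (f ` X) \<and> open U} W" for W
    using that
  proof induction
    case (Int a b)
    then show ?case by (auto intro: eventually_conj)
  next
    case (UN K)
    show ?case
    proof
      assume "L \<in> \<Union>K"
      then obtain A where "A \<in> K" "L \<in> A" by blast
      with UN.IH have "\<forall>\<^sub>F n in F. M n \<in> A" by blast
      then show "\<forall>\<^sub>F n in F. M n \<in> \<Union>K"
        by (rule eventually_mono) (use \<open>A \<in> K\<close> in blast)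
    qed
  next
    case (Basis s)
    then obtain f :: "'a \<Rightarrow> real" and U where
      s: "s = {M \<in> borel_probs X. (\<integral>x. f x \<partial>M) \<in> U}"
      and f: "continuous_on X f" "bounded (f ` X)" and U: "open U" by blast
    have "((\<lambda>n. \<integral>x. f x \<partial>M n) \<longlongrightarrow> (\<integral>x. f x \<partial>L)) F"
      using R f by blast
    then show ?case
      using s U assms by (auto dest: topological_tendstoD)
  qed auto
  then have "\<forall>W. openin (weak_star_topology X) W \<and> L \<in> W \<longrightarrow> (\<forall>\<^sub>F n in F. M n \<in> W)"
    unfolding weak_star_topology_def openin_topology_generated_by_iff by blast
  then show ?lim
    using R unfolding limitin_def topspace_weak_star by blast
qed

definition act_measure :: "('t \<Rightarrow> 'a::topological_space \<Rightarrow> 'a) \<Rightarrow> 'a set \<Rightarrow> 't \<Rightarrow> 'a measure \<Rightarrow> 'a measure" where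
  "act_measure act X t M = distr M (restrict_space borel X) (act t)"

definition point_mass :: "'a::topological_space set \<Rightarrow> 'a \<Rightarrow> 'a measure" where
  "point_mass X x = return (restrict_space borel X) x"

definition strongly_proximal :: "('t \<Rightarrow> 'a::topological_space \<Rightarrow> 'a) \<Rightarrow> 'a set \<Rightarrow> bool" where
  "strongly_proximal act X \<longleftrightarrow>
     (\<forall>M\<in>borel_probs X. \<exists>(t :: nat \<Rightarrow> 't) x. x \<in> X \<and>
        limitin (weak_star_topology X) (\<lambda>n. act_measure act X (t n) M) (point_mass X x) sequentially)"

end

theory Submission
  imports Defs
begin

text \<open>
  A semigroup of affine surjections of a simplex moves the vertices around and nothing else: the
  preimage of a vertex under an affine map is a face, hence contains a vertex, so each \<open>t\<close> maps the
  finite vertex set onto itself and therefore permutes it (\<open>affine_surj_permutes_vertices\<close>).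

  Such an action is neither proximal nor strongly proximal as soon as there are two vertices.
  Two distinct vertices stay distinct and run through a finite, hence discrete, set, so their
  orbits cannot come together (\<open>proximal_permuted_finite_set\<close>). And the uniform probability measure
  on the vertex set is fixed by every \<open>t\<close>, so it would itself have to be a point mass
  (\<open>strongly_proximal_permuted_finite_set\<close>); continuous functions separating the vertices exist
  because the simplex is compact Hausdorff.

  So either property forces \<open>X\<close> to have at most one point, and in that case both hold trivially:
  the only probability measure on a one-point space is the point mass, and the empty space
  carries none.
\<close>

section \<open>Affine surjections of a simplex\<close>

text \<open>
  The coordinate functional of \<open>w\<close> attains its maximum over the simplex only at \<open>w\<close>.
\<close>

lemma exposed_vertex_functional:
  fixes W :: "'v::real_vector set"
  assumes "independent W" "w \<in> W"
  obtains \<phi> :: "'v \<Rightarrow> real"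
    where "linear \<phi>" "\<phi> w = 1" "\<And>x. x \<in> convex hull W \<Longrightarrow> x \<noteq> w \<Longrightarrow> \<phi> x < 1"
proof -
  obtain \<phi> :: "'v \<Rightarrow> real" where lin: "linear \<phi>"
    and \<phi>: "\<And>x. x \<in> W \<Longrightarrow> \<phi> x = (if x = w then 1 else 0)"
    using linear_independent_extend[OF assms(1), of "\<lambda>x. if x = w then 1 else 0 :: real"] by blast
  have \<phi>w: "\<phi> w = 1"
    using \<phi> assms(2) by simp
  have "convex {x. \<phi> x < 1 \<or> x = w}"
  proof (rule convexI)
    fix x y and a b :: real
    assume xy: "x \<in> {x. \<phi> x < 1 \<or> x = w}" "y \<in> {x. \<phi> x < 1 \<or> x = w}"
      and ab: "0 \<le> a" "0 \<le> b" "a + b = 1"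
    have eq: "\<phi> (a *\<^sub>R x + b *\<^sub>R y) = a * \<phi> x + b * \<phi> y"
      by (simp add: linear_add[OF lin] linear_scale[OF lin])
    show "a *\<^sub>R x + b *\<^sub>R y \<in> {x. \<phi> x < 1 \<or> x = w}"
    proof (cases "a = 0 \<or> b = 0 \<or> (x = w \<and> y = w)")
      case True
      then show ?thesis
        using xy ab by (auto simp flip: scaleR_add_left)
    next
      case False
      with ab have pos: "0 < a" "0 < b" by auto
      have "\<phi> x \<le> 1" "\<phi> y \<le> 1" "\<phi> x < 1 \<or> \<phi> y < 1"
        using xy \<phi>w False by auto
      then have "a * \<phi> x + b * \<phi> y < a * 1 + b * 1"
        using pos by (meson add_le_less_mono add_less_le_mono less_eq_real_def mult_left_mono mult_strict_left_mono)
      then show ?thesis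
        using eq ab by simp
    qed
  qed
  moreover have "W \<subseteq> {x. \<phi> x < 1 \<or> x = w}"
    using \<phi> by auto
  ultimately have "convex hull W \<subseteq> {x. \<phi> x < 1 \<or> x = w}"
    by (rule hull_minimal[rotated])
  then show ?thesis
    using that lin \<phi>w by blast
qed

text \<open>
  The points sent strictly below the maximum of the coordinate functional of \<open>w\<close> form a convex set.
  If no vertex were sent to \<open>w\<close>, this set would contain all vertices, hence the whole simplex,
  contradicting surjectivity.
\<close>

lemma affine_surj_permutes_vertices:
  fixes W :: "'v::real_vector set" and f :: "'v \<Rightarrow> 'v"
  assumes "finite W" "independent W"
    and affine: "\<And>x y a. \<lbrakk>x \<in> convex hull W; y \<in> convex hull W; 0 \<le> a; a \<le> 1\<rbrakk> \<Longrightarrow>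
       f (a *\<^sub>R x + (1 - a) *\<^sub>R y) = a *\<^sub>R f x + (1 - a) *\<^sub>R f y"
    and surj: "f ` (convex hull W) = convex hull W"
  shows "bij_betw f W W"
proof -
  have "W \<subseteq> f ` W"
  proof
    fix w assume w: "w \<in> W"
    obtain \<phi> :: "'v \<Rightarrow> real" where lin: "linear \<phi>" and \<phi>w: "\<phi> w = 1"
      and less: "\<And>x. x \<in> convex hull W \<Longrightarrow> x \<noteq> w \<Longrightarrow> \<phi> x < 1"
      using exposed_vertex_functional[OF assms(2) w] by blast
    define L where "L = {x \<in> convex hull W. \<phi> (f x) < 1}"
    have "convex L"
    proof (rule convexI)
      fix x y and a b :: real
      assume xy: "x \<in> L" "y \<in> L" and ab: "0 \<le> a" "0 \<le> b" "a + b = 1"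
      have b: "b = 1 - a" and a1: "a \<le> 1"
        using ab by auto
      have hull: "x \<in> convex hull W" "y \<in> convex hull W"
        using xy by (auto simp: L_def)
      have "\<phi> (f (a *\<^sub>R x + b *\<^sub>R y)) = a * \<phi> (f x) + b * \<phi> (f y)"
        unfolding b affine[OF hull ab(1) a1] by (simp add: linear_add[OF lin] linear_scale[OF lin])
      also have "\<dots> < 1"
        using xy ab by (intro convex_bound_lt) (auto simp: L_def)
      finally show "a *\<^sub>R x + b *\<^sub>R y \<in> L"
        using convexD[OF convex_convex_hull hull ab] by (simp add: L_def)
    qed
    show "w \<in> f ` W"
    proof (rule ccontr)
      assume notin: "w \<notin> f ` W"
      have "W \<subseteq> L"
      proof
        fix u assume u: "u \<in> W"
        then have "u \<in> convex hull W"
          by (rule hull_inc)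
        moreover from this have "f u \<in> convex hull W"
          using surj by blast
        ultimately show "u \<in> L"
          using less notin u by (auto simp: L_def)
      qed
      then have "convex hull W \<subseteq> L"
        using \<open>convex L\<close> by (rule hull_minimal)
      moreover obtain p where "p \<in> convex hull W" "f p = w"
        using surj hull_inc[OF w, of convex] by (metis imageE)
      ultimately show False
        using \<phi>w by (auto simp: L_def)
    qed
  qed
  moreover have "card (f ` W) \<le> card W"
    using \<open>finite W\<close> by (rule card_image_le)
  ultimately have "f ` W = W"
    using \<open>finite W\<close> by (metis card_seteq finite_imageI)
  then show ?thesis
    using \<open>finite W\<close> by (simp add: bij_betw_def eq_card_imp_inj_on)
qed

section \<open>Compactness of finitely generated convex hulls\<close>

lemma continuous_on_scaleR_locally_convex:
  fixes f :: "'a::topological_space \<Rightarrow> real" and g :: "'a \<Rightarrow> 'v::locally_convex_space"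
  assumes "continuous_on S f" "continuous_on S g"
  shows "continuous_on S (\<lambda>x. f x *\<^sub>R g x)"
  unfolding continuous_on_def
proof
  fix x assume "x \<in> S"
  then have "LIM y (at x within S). (f y, g y) :> nhds (f x) \<times>\<^sub>F nhds (g x)"
    using assms by (intro filterlim_Pair) (auto simp: continuous_on_def)
  from filterlim_compose[OF tendsto_scaleR_Pair this]
  show "((\<lambda>y. f y *\<^sub>R g y) \<longlongrightarrow> f x *\<^sub>R g x) (at x within S)"
    by simp
qed

lemma compact_convex_hull_finite:
  fixes W :: "'v::locally_convex_space set"
  assumes "finite W"
  shows "compact (convex hull W)"
  using assms
proof induction
  case (insert a W)
  show ?case
  proof (cases "W = {}")
    case False
    have "convex hull (insert a W) =
        (\<lambda>(u, y). u *\<^sub>R a + (1 - u) *\<^sub>R y) ` ({0..1} \<times> (convex hull W))"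
      unfolding convex_hull_insert[OF False]
    proof (intro set_eqI iffI)
      fix z assume "z \<in> {z. \<exists>u\<ge>0. \<exists>v\<ge>0. \<exists>b. u + v = 1 \<and> b \<in> convex hull W \<and>
        z = u *\<^sub>R a + v *\<^sub>R b}"
      then obtain u v b where uvb: "0 \<le> u" "0 \<le> v" "u + v = 1" "b \<in> convex hull W"
        "z = u *\<^sub>R a + v *\<^sub>R b" by blast
      then have "v = 1 - u" by simp
      with uvb show "z \<in> (\<lambda>(u, y). u *\<^sub>R a + (1 - u) *\<^sub>R y) ` ({0..1} \<times> (convex hull W))"
        by (intro image_eqI[of _ _ "(u, b)"]) auto
    next
      fix z assume "z \<in> (\<lambda>(u, y). u *\<^sub>R a + (1 - u) *\<^sub>R y) ` ({0..1} \<times> (convex hull W))"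
      then obtain u y where "0 \<le> u" "u \<le> 1" "y \<in> convex hull W" "z = u *\<^sub>R a + (1 - u) *\<^sub>R y"
        by auto
      then show "z \<in> {z. \<exists>u\<ge>0. \<exists>v\<ge>0. \<exists>b. u + v = 1 \<and> b \<in> convex hull W \<and>
        z = u *\<^sub>R a + v *\<^sub>R b}"
        by (intro CollectI exI[of _ u] exI[of _ "1 - u"] conjI exI[of _ y]) auto
    qed
    moreover have "continuous_on ({0..1} \<times> (convex hull W)) (\<lambda>(u, y). u *\<^sub>R a + (1 - u) *\<^sub>R y)"
      unfolding case_prod_beta
      by (intro continuous_on_add continuous_on_scaleR_locally_convex continuous_intros)
    moreover have "compact ({0..1::real} \<times> (convex hull W))"
      using insert.IH by (intro compact_Times) auto
    ultimately show ?thesis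
      by (metis compact_continuous_image)
  qed simp
qed simp

section \<open>Uniform measures on finite sets\<close>

text \<open>
  The uniform probability on \<open>S\<close> starts out on the power set of \<open>S\<close>; pushing it forward
  along the inclusion turns it into a measure on the Borel sets of \<open>X\<close>.
\<close>

definition uniform_on :: "'a::topological_space set \<Rightarrow> 'a set \<Rightarrow> 'a measure" where
  "uniform_on X S = distr (uniform_count_measure S) (restrict_space borel X) (\<lambda>x. x)"

lemma measurable_uniform_count_measure:
  assumes "f \<in> S \<rightarrow> space M"
  shows "f \<in> measurable (uniform_count_measure S) M"
  using assms by (auto simp: measurable_def space_uniform_count_measure sets_uniform_count_measure)

lemma emeasure_uniform_on:
  assumes "finite S" "S \<noteq> {}" "S \<subseteq> X" "E \<in> sets (restrict_space borel X)"
  shows "emeasure (uniform_on X S) E = ennreal (card (E \<inter> S) / card S)"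
proof -
  have "(\<lambda>x. x) \<in> measurable (uniform_count_measure S) (restrict_space borel X)"
    using assms by (intro measurable_uniform_count_measure) (auto simp: space_restrict_space)
  then show ?thesis
    using assms unfolding uniform_on_def
    by (simp add: emeasure_distr space_uniform_count_measure emeasure_uniform_count_measure)
qed

lemma integral_uniform_on:
  fixes f :: "'a::topological_space \<Rightarrow> real"
  assumes "finite S" "S \<subseteq> X" "continuous_on X f"
  shows "(\<integral>x. f x \<partial>uniform_on X S) = (\<Sum>x\<in>S. f x) / card S"
proof -
  have "(\<lambda>x. x) \<in> measurable (uniform_count_measure S) (restrict_space borel X)"
    using assms by (intro measurable_uniform_count_measure) (auto simp: space_restrict_space)
  then have "(\<integral>x. f x \<partial>uniform_on X S) = (\<integral>x. f x \<partial>uniform_count_measure S)"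
    unfolding uniform_on_def
    by (intro integral_distr borel_measurable_continuous_on_restrict assms)
  also have "\<dots> = (\<Sum>x\<in>S. f x) / card S"
    unfolding uniform_count_measure_def using assms(1)
    by (subst lebesgue_integral_point_measure_finite) (auto simp: sum_divide_distrib)
  finally show ?thesis .
qed

text \<open>
  Regularity is witnessed by single sets: from outside by removing from \<open>X\<close> the atoms not in \<open>E\<close>,
  from inside by the finite set of atoms in \<open>E\<close>.
\<close>

lemma uniform_on_in_borel_probs:
  fixes X :: "'a::t1_space set"
  assumes "finite S" "S \<noteq> {}" "S \<subseteq> X"
  shows "uniform_on X S \<in> borel_probs X"
proof -
  let ?B = "restrict_space borel X :: 'a measure"
  have sets: "sets (uniform_on X S) = sets ?B"
    by (simp add: uniform_on_def)
  have meas: "(\<lambda>x. x) \<in> measurable (uniform_count_measure S) ?B"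
    using assms by (intro measurable_uniform_count_measure) (auto simp: space_restrict_space)
  interpret prob_space "uniform_count_measure S"
    using assms by (intro prob_space_uniform_count_measure)
  have "prob_space (uniform_on X S)"
    unfolding uniform_on_def by (rule prob_space_distr[OF meas])
  moreover have "borel_regular X (uniform_on X S)"
    unfolding borel_regular_def
  proof (intro ballI conjI)
    fix E assume "E \<in> sets (uniform_on X S)"
    then have E: "E \<in> sets ?B"
      by (simp add: sets)
    then have EX: "E \<subseteq> X"
      using sets.sets_into_space[OF E] by (simp add: space_restrict_space)
    have open_sets: "U \<in> sets ?B" if "openin (top_of_set X) U" for U
      using that by (auto simp: openin_open sets_restrict_space)
    have eq: "emeasure (uniform_on X S) A = emeasure (uniform_on X S) E"
      if "A \<in> sets ?B" "A \<inter> S = E \<inter> S" for A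
      using that E assms by (simp add: emeasure_uniform_on)
    define U where "U = X - (S - E)"
    have "closed (S - E)"
      using assms(1) by (simp add: finite_imp_closed)
    then have U: "openin (top_of_set X) U"
      unfolding U_def openin_open by (intro exI[of _ "- (S - E)"] conjI open_Compl) auto
    have "emeasure (uniform_on X S) U = emeasure (uniform_on X S) E"
      using EX assms(3) by (intro eq open_sets[OF U]) (auto simp: U_def)
    moreover have "E \<subseteq> U"
      using EX by (auto simp: U_def)
    ultimately show "emeasure (uniform_on X S) E =
        (INF U\<in>{U. openin (top_of_set X) U \<and> E \<subseteq> U}. emeasure (uniform_on X S) U)"
      using U open_sets
      by (intro INF_eqI[symmetric]) (force simp: sets intro: emeasure_mono)+
    have fin: "finite (E \<inter> S)"
      using assms(1) by simp
    then have "closed (E \<inter> S)"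
      by (rule finite_imp_closed)
    then have "emeasure (uniform_on X S) (E \<inter> S) = emeasure (uniform_on X S) E"
      using EX by (intro eq) (auto simp: sets_restrict_space intro!: image_eqI[of _ _ "E \<inter> S"])
    moreover have "compact (E \<inter> S)"
      using fin by (rule finite_imp_compact)
    ultimately show "emeasure (uniform_on X S) E =
        (SUP K\<in>{K. compact K \<and> K \<subseteq> E}. emeasure (uniform_on X S) K)"
      using E by (intro SUP_eqI[symmetric]) (force simp: sets intro: emeasure_mono)+
  qed
  ultimately show ?thesis
    using sets by (simp add: borel_probs_def)
qed

lemma measurable_act:
  assumes "semigroup_action act X"
  shows "act t \<in> measurable (restrict_space borel X) (restrict_space borel X)"
  using assms unfolding semigroup_action_def
  by (intro measurable_restrict_space2 borel_measurable_continuous_on_restrict)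
    (auto simp: space_restrict_space)

lemma act_measure_uniform_on:
  assumes "semigroup_action act X" "finite S" "S \<noteq> {}" "S \<subseteq> X" "bij_betw (act t) S S"
  shows "act_measure act X t (uniform_on X S) = uniform_on X S"
proof (rule measure_eqI)
  show "sets (act_measure act X t (uniform_on X S)) = sets (uniform_on X S)"
    by (simp add: act_measure_def uniform_on_def)
next
  fix E assume "E \<in> sets (act_measure act X t (uniform_on X S))"
  then have E: "E \<in> sets (restrict_space borel X)"
    by (simp add: act_measure_def)
  have sets: "sets (uniform_on X S) = sets (restrict_space borel X)"
    and space: "space (uniform_on X S) = X"
    by (simp_all add: uniform_on_def space_restrict_space)
  have m: "act t \<in> measurable (uniform_on X S) (restrict_space borel X)"
    using measurable_act[OF assms(1), of t] measurable_cong_sets[OF sets refl] by blast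
  have "act t -` E \<inter> X \<in> sets (restrict_space borel X)"
    using measurable_sets[OF m E] by (simp add: sets space)
  then have "emeasure (act_measure act X t (uniform_on X S)) E =
      ennreal (card ((act t -` E \<inter> X) \<inter> S) / card S)"
    unfolding act_measure_def
    using assms E by (subst emeasure_distr[OF m E]) (simp add: space emeasure_uniform_on)
  also have "card ((act t -` E \<inter> X) \<inter> S) = card (E \<inter> S)"
  proof (rule bij_betw_same_card)
    have "act t ` ((act t -` E \<inter> X) \<inter> S) = E \<inter> act t ` S"
      using assms(4) by auto
    then show "bij_betw (act t) ((act t -` E \<inter> X) \<inter> S) (E \<inter> S)"
      using assms(5) by (auto simp: bij_betw_def intro: inj_on_subset)
  qed
  finally show "emeasure (act_measure act X t (uniform_on X S)) E = emeasure (uniform_on X S) E"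
    using assms E by (simp add: emeasure_uniform_on)
qed

section \<open>Actions permuting a finite set\<close>

text \<open>
  A finite set is discrete, so orbits inside it converge only by becoming constant.
\<close>

lemma proximal_permuted_finite_set:
  fixes X :: "'a::t1_space set"
  assumes "proximal act X" "finite W" "W \<subseteq> X" "\<And>t. bij_betw (act t) W W"
    and "x \<in> W" "y \<in> W"
  shows "x = y"
proof -
  obtain t z where lim: "(\<lambda>n::nat. act (t n) x) \<longlonglongrightarrow> z" "(\<lambda>n. act (t n) y) \<longlonglongrightarrow> z"
    using assms unfolding proximal_def by (meson subsetD)
  have "open (- (W - {z}))"
    using \<open>finite W\<close> by (intro open_Compl finite_imp_closed) simp
  then have ev: "\<forall>\<^sub>F n in sequentially. act (t n) x \<in> - (W - {z})"
    "\<forall>\<^sub>F n in sequentially. act (t n) y \<in> - (W - {z})"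
    by (rule topological_tendstoD[OF lim(1)] topological_tendstoD[OF lim(2)], simp)+
  obtain n where "act (t n) x \<in> - (W - {z})" "act (t n) y \<in> - (W - {z})"
    using eventually_happens'[OF sequentially_bot eventually_conj[OF ev]] by blast
  moreover have "act (t n) x \<in> W" "act (t n) y \<in> W"
    using assms by (auto dest: bij_betwE)
  ultimately have "act (t n) x = act (t n) y"
    by simp
  then show ?thesis
    using assms by (metis bij_betw_imp_inj_on inj_onD)
qed

text \<open>
  The uniform measure on \<open>W\<close> is a fixed point of the action, so strong proximality makes it
  indistinguishable from some point mass at \<open>z\<close> by continuous functions. A function vanishing at \<open>z\<close>
  and equal to 1 on the rest of \<open>W\<close> then shows that there is no rest.
\<close>

lemma strongly_proximal_permuted_finite_set:
  fixes X :: "'a::t2_space set"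
  assumes sp: "strongly_proximal act X" and act: "semigroup_action act X" and "compact X"
    and W: "finite W" "W \<subseteq> X" "\<And>t. bij_betw (act t) W W"
    and "x \<in> W" "y \<in> W"
  shows "x = y"
proof -
  have "W \<noteq> {}"
    using \<open>x \<in> W\<close> by blast
  let ?\<mu> = "uniform_on X W"
  have \<mu>: "?\<mu> \<in> borel_probs X"
    using W \<open>W \<noteq> {}\<close> by (intro uniform_on_in_borel_probs)
  then obtain t z where z: "z \<in> X"
    and lim: "limitin (weak_star_topology X) (\<lambda>n::nat. act_measure act X (t n) ?\<mu>) (point_mass X z)
      sequentially"
    using sp unfolding strongly_proximal_def by blast
  have \<mu>_fixed: "act_measure act X s ?\<mu> = ?\<mu>" for s
    using act W \<open>W \<noteq> {}\<close> by (intro act_measure_uniform_on)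
  have "Hausdorff_space (euclidean :: 'a topology)"
    unfolding Hausdorff_space_def disjnt_def by (simp, metis hausdorff)
  then have "normal_space (top_of_set X)"
    using \<open>compact X\<close>
    by (intro compact_Hausdorff_or_regular_imp_normal_space)
      (simp_all add: compact_space_subtopology Hausdorff_space_subtopology)
  moreover have "closedin (top_of_set X) {z}" "closedin (top_of_set X) (W - {z})"
    using z W by (auto intro!: closed_subset finite_imp_closed)
  moreover have "disjnt {z} (W - {z})"
    by simp
  ultimately obtain f :: "'a \<Rightarrow> real" where f: "continuous_map (top_of_set X) (top_of_set {0..1}) f"
    and f0: "f ` {z} \<subseteq> {0}" and f1: "f ` (W - {z}) \<subseteq> {1}"
    by (rule Urysohn_lemma[where a = 0 and b = 1]) auto
  have cont: "continuous_on X f" and "f ` X \<subseteq> {0..1}"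
    using f by (auto simp: continuous_map_in_subtopology)
  then have "bounded (f ` X)"
    using bounded_closed_interval bounded_subset by blast
  then have "(\<lambda>_::nat. \<integral>x. f x \<partial>?\<mu>) \<longlonglongrightarrow> (\<integral>x. f x \<partial>point_mass X z)"
    using lim cont \<mu> by (simp add: \<mu>_fixed limitin_weak_star)
  then have "(\<integral>x. f x \<partial>?\<mu>) = (\<integral>x. f x \<partial>point_mass X z)"
    by (simp add: LIMSEQ_const_iff)
  also have "\<dots> = f z"
    unfolding point_mass_def using z cont
    by (intro integral_return borel_measurable_continuous_on_restrict)
      (auto simp: space_restrict_space)
  finally have "(\<Sum>w\<in>W. f w) = 0"
    using W f0 cont \<open>W \<noteq> {}\<close> by (simp add: integral_uniform_on)
  moreover have "\<forall>w\<in>W. 0 \<le> f w"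
    using W \<open>f ` X \<subseteq> {0..1}\<close> by fastforce
  ultimately have "\<forall>w\<in>W. f w = 0"
    using \<open>finite W\<close> sum_nonneg_eq_0_iff by blast
  then have "W \<subseteq> {z}"
    using f1 by fastforce
  then show ?thesis
    using assms by blast
qed

section \<open>Actions on at most one point\<close>

lemma proximal_subsingleton:
  fixes act :: "'t::semigroup_mult \<Rightarrow> 'a::topological_space \<Rightarrow> 'a"
  assumes "semigroup_action act X" "X \<subseteq> {p}"
  shows "proximal act X"
  unfolding proximal_def
proof (intro ballI)
  fix x y assume xy: "x \<in> X" "y \<in> X"
  then have "act t x = p" "act t y = p" "p \<in> X" for t
    using assms unfolding semigroup_action_def by blast+
  then show "\<exists>(t :: nat \<Rightarrow> 't) z. z \<in> X \<and> (\<lambda>n. act (t n) x) \<longlonglongrightarrow> z \<and> (\<lambda>n. act (t n) y) \<longlonglongrightarrow> z"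
    by auto
qed

lemma prob_space_singleton_eq_point_mass:
  assumes "prob_space M" "sets M = sets (restrict_space borel {p})"
  shows "M = point_mass {p} p"
proof (rule measure_eqI)
  show "sets M = sets (point_mass {p} p)"
    using assms by (simp add: point_mass_def)
next
  fix E assume E: "E \<in> sets M"
  have space: "space M = {p}"
    using sets_eq_imp_space_eq[OF assms(2)] by (simp add: space_restrict_space)
  consider "E = {}" | "E = space M"
    using sets.sets_into_space[OF E] space by auto
  then show "emeasure M E = emeasure (point_mass {p} p) E"
  proof cases
    case 2
    then show ?thesis
      using prob_space.emeasure_space_1[OF assms(1)] E assms(2) space
      by (simp add: point_mass_def)
  qed simp
qed

lemma strongly_proximal_subsingleton:
  fixes act :: "'t::semigroup_mult \<Rightarrow> 'a::topological_space \<Rightarrow> 'a"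
  assumes act: "semigroup_action act X" and "X \<subseteq> {p}"
  shows "strongly_proximal act X"
  unfolding strongly_proximal_def
proof
  fix M assume M: "M \<in> borel_probs X"
  then have prob: "prob_space M" and sets: "sets M = sets (restrict_space borel X)"
    by (auto simp: borel_probs_def)
  have "space M = X"
    using sets_eq_imp_space_eq[OF sets] by (simp add: space_restrict_space)
  then have X: "X = {p}"
    using prob_space.not_empty[OF prob] \<open>X \<subseteq> {p}\<close> by auto
  have "act t \<in> measurable M (restrict_space borel X)" for t
    using measurable_act[OF act, of t] measurable_cong_sets[OF sets refl] by blast
  then have "prob_space (act_measure act X t M)" for t
    unfolding act_measure_def by (rule prob_space.prob_space_distr[OF prob])
  then have "act_measure act X t M = point_mass X p" for t
    unfolding X by (rule prob_space_singleton_eq_point_mass) (simp add: act_measure_def)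
  moreover have "M = point_mass X p"
    using prob sets unfolding X by (rule prob_space_singleton_eq_point_mass)
  ultimately show "\<exists>(t :: nat \<Rightarrow> 't) x. x \<in> X \<and>
      limitin (weak_star_topology X) (\<lambda>n. act_measure act X (t n) M) (point_mass X x) sequentially"
    using M X by (intro exI[of _ "\<lambda>_. undefined"] exI[of _ p]) simp
qed

section \<open>Proximality and strong proximality on a simplex\<close>

theorem corollary1:
  fixes v :: "nat \<Rightarrow> 'v::locally_convex_space"
    and n :: nat
    and X :: "'v set"
    and act :: "'t::topological_semigroup_mult \<Rightarrow> 'v \<Rightarrow> 'v"
  assumes "inj_on v {1..n}"
    and "independent (v ` {1..n})"
    and "X = convex hull (v ` {1..n})"
    and "affine_action act X"
    and "\<forall>t. act t ` X = X"
  shows "proximal act X \<longleftrightarrow> strongly_proximal act X"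
proof -
  define W where "W = v ` {1..n}"
  have W: "finite W" "W \<subseteq> X" and X: "X = convex hull W"
    using assms(3) by (auto simp: W_def hull_inc)
  have act: "semigroup_action act X"
    using assms(4) by (simp add: affine_action_def)
  have perm: "bij_betw (act t) W W" for t
  proof (rule affine_surj_permutes_vertices)
    show "independent W"
      using assms(2) by (simp add: W_def)
    show "act t ` (convex hull W) = convex hull W"
      using assms(5) X by simp
  qed (use W assms(4) in \<open>auto simp: affine_action_def X\<close>)
  have "compact X"
    unfolding X using W(1) by (rule compact_convex_hull_finite)
  have subsingleton: "\<exists>p. X \<subseteq> {p}" if "\<And>x y. x \<in> W \<Longrightarrow> y \<in> W \<Longrightarrow> x = y"
  proof -
    obtain p where "W \<subseteq> {p}"
      using \<open>\<And>x y. x \<in> W \<Longrightarrow> y \<in> W \<Longrightarrow> x = y\<close> by blast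
    then have "X \<subseteq> {p}"
      unfolding X by (rule hull_minimal) simp
    then show ?thesis ..
  qed
  show ?thesis
  proof
    assume "proximal act X"
    then have "\<exists>p. X \<subseteq> {p}"
      using W perm by (intro subsingleton) (rule proximal_permuted_finite_set)
    then show "strongly_proximal act X"
      using strongly_proximal_subsingleton[OF act] by blast
  next
    assume "strongly_proximal act X"
    then have "\<exists>p. X \<subseteq> {p}"
      using act \<open>compact X\<close> W perm
      by (intro subsingleton) (rule strongly_proximal_permuted_finite_set)
    then show "proximal act X"
      using proximal_subsingleton[OF act] by blast
  qed
qed

end
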